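(* With the polynomials $P_{n,k}$ and $Q_{n,k}^{(0,1,1)}$, $Q_{n,k}^{(1,0,1)}$, $Q_{n,k}^{(1,1,0)}$ defined in the context, and with $\frac{\partial}{\partial z}:=\frac{\partial}{\partial y}-\frac{\partial}{\partial x}$, the following identities of polynomials in $(x,y)$ hold for all integers $n\ge1$. (1) $\frac{\partial}{\partial y}Q_{n,0}^{(0,1,1)}=0$; $\quad\frac{\partial}{\partial y}Q_{n,1}^{(0,1,1)}=-2P_{n-1,0}$; $\quad\frac{\partial}{\partial y}Q_{n,k}^{(0,1,1)}=(1-k)P_{n-1,k-1}$ for $2\le k\le n$. (2) $\frac{\partial}{\partial x}Q_{n,0}^{(1,0,1)}=n\,P_{n-1,0}$; $\quad\frac{\partial}{\partial x}Q_{n,k}^{(1,0,1)}=\frac{k-n}{2}\left[P_{n-1,k-1}+P_{n-1,k}\right]$ for $1\le k\le n-1$; $\quad\frac{\partial}{\partial x}Q_{n,n}^{(1,0,1)}=-n\,P_{n-1,n-1}$. (3) $\frac{\partial}{\partial z}Q_{n,0}^{(1,1,0)}=-n\,P_{n-1,0}$; $\quad\frac{\partial}{\partial z}Q_{n,k}^{(1,1,0)}=\frac{n-k}{2}\left[P_{n-1,k-1}-P_{n-1,k}\right]$ for $1\le k\le n-1$; $\quad\frac{\partial}{\partial z}Q_{n,n}^{(1,1,0)}=n\,P_{n-1,n-1}$.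
   Context: Let $P_k^{(\alpha,\beta)}$ denote the classical degree-$k$ Jacobi polynomial on $[-1,1]$ (standard normalization $P_k^{(\alpha,\beta)}(1)=\binom{k+\alpha}{k}$), and let $\tilde P_k^{(\alpha,\beta)}(x)=P_k^{(\alpha,\beta)}(2x-1)$ be the shifted Jacobi polynomial on $[0,1]$. For $a,b,c>-1$ and integers $n\ge k\ge 0$ the Jacobi polynomials on the triangle are $$P_{n,k}^{(a,b,c)}(x,y)=\tilde P_{n-k}^{(2k+b+c+1,a)}(x)\,(1-x)^k\,\tilde P_k^{(c,b)}\!\left(\tfrac{y}{1-x}\right),$$ and $P_{n,k}:=P_{n,k}^{(0,0,0)}$. These are polynomials in $x,y$. Put $z:=1-x-y$. Two-edge Dirichlet bases (for $n\ge1$): - $Q_{n,0}^{(1,1,0)}:=x\,\tilde P_{n-1}^{(0,1)}(x)$; $Q_{n,k}^{(1,1,0)}:=xy\,P_{n-2,k-1}^{(1,1,0)}$ for $1\le k\le n-1$; $Q_{n,n}^{(1,1,0)}:=y\,P_{n-1,n-1}^{(0,1,0)}$. - $Q_{n,0}^{(1,0,1)}:=x\,\tilde P_{n-1}^{(0,1)}(x)$; $Q_{n,k}^{(1,0,1)}:=xz\,P_{n-2,k-1}^{(1,0,1)}$ for $1\le k\le n-1$; $Q_{n,n}^{(1,0,1)}:=z\,P_{n-1,n-1}^{(0,0,1)}$. - $Q_{n,0}^{(0,1,1)}:=(1-x)P_{n-1,0}=(1-x)\tilde P_{n-1}^{(1,0)}(x)$; $Q_{n,1}^{(0,1,1)}:=(1-x-2y)P_{n-1,0}=(1-x-2y)\tilde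 P_{n-1}^{(1,0)}(x)$; $Q_{n,k}^{(0,1,1)}:=yz\,P_{n-2,k-2}^{(0,1,1)}$ for $2\le k\le n$. *)

theory Defs
  imports Complex_Main "HOL-Computational_Algebra.Polynomial"
begin

text \<open>The classical Jacobi polynomial, by its terminating hypergeometric expansion
  \<open>(\<alpha>+1)\<^sub>k / k! \<cdot> \<^sub>2F\<^sub>1(-k, k+\<alpha>+\<beta>+1; \<alpha>+1; (1-x)/2)\<close>
  with \<open>(\<cdot>)\<^sub>k\<close> the Pochhammer symbol; meaningful for \<open>\<alpha> > -1\<close>.\<close>

definition jacobi_poly :: "nat \<Rightarrow> real \<Rightarrow> real \<Rightarrow> real poly" where
  "jacobi_poly k \<alpha> \<beta> =
     smult (pochhammer (\<alpha> + 1) k / fact k)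
       (\<Sum>s\<le>k. smult (pochhammer (- real k) s * pochhammer (real k + \<alpha> + \<beta> + 1) s
                       / (pochhammer (\<alpha> + 1) s * fact s))
                ([:1/2, -1/2:] ^ s))"

definition shifted_jacobi :: "nat \<Rightarrow> real \<Rightarrow> real \<Rightarrow> real poly" where
  "shifted_jacobi k \<alpha> \<beta> = jacobi_poly k \<alpha> \<beta> \<circ>\<^sub>p [:-1, 2:]"

text \<open>A polynomial in \<open>(x, y)\<close> is a polynomial in \<open>y\<close> (outer) whose coefficients are
  polynomials in \<open>x\<close> (inner). So \<open>[:q:]\<close> is \<open>q(x)\<close>, and \<open>[:[:c:]:]\<close> is a constant.\<close>

type_synonym bipoly = "real poly poly"

definition eval2 :: "bipoly \<Rightarrow> real \<Rightarrow> real \<Rightarrow> real" where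
  "eval2 p x y = poly (poly p [:y:]) x"

definition X :: bipoly where "X = [:[:0, 1:]:]"
definition Y :: bipoly where "Y = [:0, 1:]"
definition Z :: bipoly where "Z = 1 - X - Y"

definition scale :: "real \<Rightarrow> bipoly \<Rightarrow> bipoly" where
  "scale c p = smult [:c:] p"

definition d_dx :: "bipoly \<Rightarrow> bipoly" where "d_dx p = map_poly pderiv p"
definition d_dy :: "bipoly \<Rightarrow> bipoly" where "d_dy p = pderiv p"
definition d_dz :: "bipoly \<Rightarrow> bipoly" where "d_dz p = d_dy p - d_dx p"

text \<open>The polynomial \<open>(1-x)\<^sup>k q(y/(1-x))\<close> for \<open>q\<close> of degree at most \<open>k\<close>, with the
  denominators cleared.\<close>

definition homog :: "nat \<Rightarrow> real poly \<Rightarrow> bipoly" where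
  "homog k q = (\<Sum>i\<le>k. scale (coeff q i) (Y ^ i * (1 - X) ^ (k - i)))"

definition jacobi_tri :: "real \<Rightarrow> real \<Rightarrow> real \<Rightarrow> nat \<Rightarrow> nat \<Rightarrow> bipoly" where
  "jacobi_tri a b c n k =
     [:shifted_jacobi (n - k) (2 * real k + b + c + 1) a:] * homog k (shifted_jacobi k c b)"

abbreviation P :: "nat \<Rightarrow> nat \<Rightarrow> bipoly" where
  "P \<equiv> jacobi_tri 0 0 0"

text \<open>The bases below are meant for \<open>n \<ge> 1\<close> and \<open>k \<le> n\<close>; all subtractions are then exact.\<close>

definition Q110 :: "nat \<Rightarrow> nat \<Rightarrow> bipoly" where
  "Q110 n k =
     (if k = 0 then X * [:shifted_jacobi (n - 1) 0 1:]
      else if k < n then X * Y * jacobi_tri 1 1 0 (n - 2) (k - 1)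
      else Y * jacobi_tri 0 1 0 (n - 1) (n - 1))"

definition Q101 :: "nat \<Rightarrow> nat \<Rightarrow> bipoly" where
  "Q101 n k =
     (if k = 0 then X * [:shifted_jacobi (n - 1) 0 1:]
      else if k < n then X * Z * jacobi_tri 1 0 1 (n - 2) (k - 1)
      else Z * jacobi_tri 0 0 1 (n - 1) (n - 1))"

definition Q011 :: "nat \<Rightarrow> nat \<Rightarrow> bipoly" where
  "Q011 n k =
     (if k = 0 then (1 - X) * P (n - 1) 0
      else if k = 1 then (1 - X - scale 2 Y) * P (n - 1) 0
      else Y * Z * jacobi_tri 0 1 1 (n - 2) (k - 2))"

text \<open>Standard normalization, and agreement of the algebraic encoding with the usual
  functions and partial derivatives.\<close>

lemma poly_jacobi_poly_1: "poly (jacobi_poly k \<alpha> \<beta>) 1 = (real k + \<alpha>) gchoose k"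
proof -
  have "(\<Sum>s\<le>k. pochhammer (- real k) s * pochhammer (real k + \<alpha> + \<beta> + 1) s
          / (pochhammer (\<alpha> + 1) s * fact s) * 0 ^ s) =
        (\<Sum>s\<le>k. if s = 0 then 1 else (0::real))"
    by (intro sum.cong) auto
  then show ?thesis
    by (simp add: jacobi_poly_def poly_sum gbinomial_pochhammer' add_ac)
qed

lemma degree_jacobi_poly: "degree (jacobi_poly k \<alpha> \<beta>) \<le> k"
proof -
  have "degree ([:1/2, -1/2:] ^ s :: real poly) \<le> s" for s
    using degree_power_le[of "[:1/2, -1/2:] :: real poly" s] by simp
  then show ?thesis
    unfolding jacobi_poly_def
    by (intro degree_smult_le[THEN order_trans] degree_sum_le) (auto intro: order_trans)
qed

lemma degree_shifted_jacobi: "degree (shifted_jacobi k \<alpha> \<beta>) \<le> k"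
  using degree_jacobi_poly[of k \<alpha> \<beta>]
  by (simp add: shifted_jacobi_def degree_pcompose)

lemma poly_shifted_jacobi: "poly (shifted_jacobi k \<alpha> \<beta>) x = poly (jacobi_poly k \<alpha> \<beta>) (2 * x - 1)"
  by (simp add: shifted_jacobi_def poly_pcompose algebra_simps)

lemma eval2_simps [simp]:
  "eval2 (p + q) x y = eval2 p x y + eval2 q x y"
  "eval2 (p - q) x y = eval2 p x y - eval2 q x y"
  "eval2 (p * q) x y = eval2 p x y * eval2 q x y"
  "eval2 (p ^ m) x y = eval2 p x y ^ m"
  "eval2 (scale c p) x y = c * eval2 p x y"
  "eval2 [:r:] x y = poly r x"
  "eval2 0 x y = 0" "eval2 1 x y = 1" "eval2 X x y = x" "eval2 Y x y = y"
  "eval2 Z x y = 1 - x - y"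
  by (simp_all add: eval2_def scale_def X_def Y_def Z_def poly_power)

lemma eval2_sum: "eval2 (\<Sum>i\<in>A. f i) x y = (\<Sum>i\<in>A. eval2 (f i) x y)"
  by (induction A rule: infinite_finite_induct) simp_all

lemma eval2_homog:
  assumes "degree q \<le> k" "x \<noteq> 1"
  shows "eval2 (homog k q) x y = (1 - x) ^ k * poly q (y / (1 - x))"
proof -
  have "poly q t = (\<Sum>i\<le>k. coeff q i * t ^ i)" for t
    unfolding poly_altdef using assms(1)
    by (intro sum.mono_neutral_left) (auto simp: coeff_eq_0)
  then show ?thesis
    using assms(2)
    by (simp add: homog_def eval2_sum sum_distrib_left power_divide power_diff field_simps)
qed

lemma eval2_jacobi_tri:
  assumes "x \<noteq> 1"
  shows "eval2 (jacobi_tri a b c n k) x y =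
    poly (shifted_jacobi (n - k) (2 * real k + b + c + 1) a) x *
    (1 - x) ^ k * poly (shifted_jacobi k c b) (y / (1 - x))"
  using assms
  by (simp add: jacobi_tri_def eval2_homog degree_shifted_jacobi del: mult_pCons_left)

lemma eval2_pCons: "eval2 (pCons r p) x y = poly r x + y * eval2 p x y"
  by (simp add: eval2_def)

lemma has_field_derivative_d_dx:
  "((\<lambda>t. eval2 p t y) has_field_derivative eval2 (d_dx p) x y) (at x)"
proof (induction p)
  case 0
  then show ?case by (simp add: d_dx_def)
next
  case (pCons r p)
  then show ?case
    by (auto simp: d_dx_def eval2_pCons map_poly_pCons intro!: derivative_eq_intros)
qed

lemma has_field_derivative_d_dy:
  "((\<lambda>t. eval2 p x t) has_field_derivative eval2 (d_dy p) x y) (at y)"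
proof (induction p)
  case 0
  then show ?case by (simp add: d_dy_def)
next
  case (pCons r p)
  then show ?case
    by (auto simp: d_dy_def eval2_pCons pderiv_pCons intro!: derivative_eq_intros)
qed

end

theory Submission
  imports Defs
begin

text \<open>In the collapsed coordinates \<open>x\<close> and \<open>t = y/(1-x)\<close> every basis polynomial is a product
  \<open>a(x) g(t)\<close>, so its derivatives combine \<open>a' g\<close> with \<open>a g'\<close> times \<open>1\<close>, \<open>t\<close> or \<open>1-t\<close>.
  Write \<open>S(m,\<alpha>,\<beta>)\<close> for the shifted Jacobi polynomial. On the \<open>t\<close> side,
  \<open>H = t S(m,0,1)\<close> and \<open>G = (1-t) S(m,1,0)\<close> satisfy \<open>t G' = -(m+1) H\<close> and
  \<open>(1-t) H' = (m+1) G\<close>, while \<open>H + G\<close> and \<open>H - G\<close> are the shifted Legendre polynomials of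
  degrees \<open>m\<close> and \<open>m+1\<close>. On the \<open>x\<close> side, \<open>F = x S(r,\<alpha>,1)\<close> satisfies
  \<open>F' = (r+1) S(r,\<alpha>+1,0)\<close> and \<open>\<alpha> F - (1-x) F' = (r+1) S(r+1,\<alpha>-1,0)\<close>.
  All of these are comparisons of hypergeometric coefficients in powers of \<open>1-x\<close>.\<close>

section \<open>Jacobi polynomials expanded at the right endpoint\<close>

definition jacobi_coeff :: "nat \<Rightarrow> real \<Rightarrow> real \<Rightarrow> nat \<Rightarrow> real" where
  "jacobi_coeff m \<alpha> \<beta> s =
     pochhammer (\<alpha> + 1) m / fact m *
     (pochhammer (- real m) s * pochhammer (real m + \<alpha> + \<beta> + 1) s
       / (pochhammer (\<alpha> + 1) s * fact s))"

definition endpoint_jacobi :: "nat \<Rightarrow> real \<Rightarrow> real \<Rightarrow> real poly" where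
  "endpoint_jacobi m \<alpha> \<beta> = (\<Sum>s\<le>m. monom (jacobi_coeff m \<alpha> \<beta> s) s)"

text \<open>The factor \<open>pochhammer (- real m) s\<close> vanishes for \<open>s > m\<close>, so
  the formula also yields the zero coefficients beyond the degree. Coefficient comparisons then need
  no case split on the range of \<open>s\<close>.\<close>

lemma coeff_endpoint_jacobi: "coeff (endpoint_jacobi m \<alpha> \<beta>) s = jacobi_coeff m \<alpha> \<beta> s"
  by (auto simp: endpoint_jacobi_def coeff_sum jacobi_coeff_def pochhammer_of_nat_eq_0_iff)

text \<open>The hypergeometric argument \<open>(1 - (2*x - 1)) / 2\<close> is \<open>1 - x\<close>.
  In the variable \<open>u = 1 - x\<close> of \<open>endpoint_jacobi\<close>,
  \<open>[:0, 1:]\<close> therefore stands for \<open>1 - x\<close> and \<open>[:1, -1:]\<close> for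
  \<open>x\<close>.\<close>

lemma shifted_jacobi_eq: "shifted_jacobi m \<alpha> \<beta> = endpoint_jacobi m \<alpha> \<beta> \<circ>\<^sub>p [:1, -1:]"
proof -
  have "poly (shifted_jacobi m \<alpha> \<beta>) x = poly (endpoint_jacobi m \<alpha> \<beta> \<circ>\<^sub>p [:1, -1:]) x" for x
  proof -
    have u: "1 / 2 - (2 * x - 1) / 2 = 1 - x"
      by (simp add: field_simps)
    show ?thesis
      by (simp add: poly_shifted_jacobi jacobi_poly_def endpoint_jacobi_def poly_pcompose poly_sum
          poly_monom sum_distrib_left jacobi_coeff_def u) (simp add: mult_ac)
  qed
  then show ?thesis
    by (simp add: poly_eq_poly_eq_iff[symmetric] fun_eq_iff)
qed

lemma jacobi_coeff_Suc:
  "jacobi_coeff m \<alpha> \<beta> (Suc s) =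
    jacobi_coeff m \<alpha> \<beta> s * ((real s - real m) * (real m + \<alpha> + \<beta> + 1 + real s))
      / ((\<alpha> + 1 + real s) * (real s + 1))"
  by (simp add: jacobi_coeff_def pochhammer_Suc field_simps)

text \<open>Peeling \<open>pochhammer a (Suc s)\<close> at its first and at its last factor gives
  the two sides.\<close>

lemma pochhammer_shift: "a * pochhammer (a + 1) s = (a + real s) * pochhammer (a :: real) s"
  using pochhammer_rec[of a s] pochhammer_Suc[of a s] by (simp add: mult_ac)

text \<open>The sum of the two parameters is the same on both sides, so the numerator symbols agree
  and only \<open>pochhammer (\<alpha> + 1)\<close> at \<open>m\<close> and at \<open>s\<close>
  shifts.\<close>

lemma jacobi_coeff_raise_alpha:
  assumes "\<alpha> > -1"
  shows "jacobi_coeff m (\<alpha> + 1) \<beta> s =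
    (\<alpha> + 1 + real m) / (\<alpha> + 1 + real s) * jacobi_coeff m \<alpha> (\<beta> + 1) s"
proof -
  have "pochhammer (\<alpha> + 1 + 1) j = (\<alpha> + 1 + real j) * pochhammer (\<alpha> + 1) j / (\<alpha> + 1)" for j
    using pochhammer_shift[of "\<alpha> + 1" j] assms by (simp add: field_simps)
  note e = this[of m] this[of s]
  have "pochhammer (\<alpha> + 1) s > 0" "\<alpha> + 1 + real s > 0"
    using assms by (auto intro!: pochhammer_pos)
  then show ?thesis
    using assms unfolding jacobi_coeff_def e
    by (simp add: divide_simps add_ac)
qed

text \<open>This is the classical derivative rule for Jacobi polynomials, read off coefficientwise:
  each Pochhammer symbol on the left loses its first factor.\<close>

lemma jacobi_coeff_lower_degree:
  assumes "\<alpha> > 0"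
  shows "jacobi_coeff (Suc m) (\<alpha> - 1) \<beta> (Suc s) =
    - (real m + \<alpha> + \<beta> + 1) / (real s + 1) * jacobi_coeff m \<alpha> (\<beta> + 1) s"
proof -
  have "pochhammer (\<alpha> + 1) s > 0"
    using assms by (auto intro!: pochhammer_pos)
  then show ?thesis
    using assms
    apply (simp add: jacobi_coeff_def pochhammer_rec divide_simps del: of_nat_Suc)
    apply (simp add: algebra_simps)
    done
qed

text \<open>With \<open>c\<close> the coefficients for parameters \<open>\<alpha>\<close>, 1, the
  left side has coefficients \<open>(s+1) * (c (s+1) - c s)\<close>. The term ratio turns this into
  a multiple of \<open>c s\<close> whose numerator \<open>(s-m)*(m+\<alpha>+2+s) -
  (s+1)*(\<alpha>+1+s) = -(m+1)*(m+\<alpha>+1)\<close> is free of \<open>s\<close>.\<close>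

lemma pderiv_endpoint_jacobi_edge:
  assumes "\<alpha> > -1"
  shows "pderiv ([:1, -1:] * endpoint_jacobi m \<alpha> 1) =
    smult (- real (Suc m)) (endpoint_jacobi m (\<alpha> + 1) 0)"
proof (rule poly_eqI)
  fix s
  have "\<alpha> + 1 + real s > 0" using assms by simp
  then show "coeff (pderiv ([:1, -1:] * endpoint_jacobi m \<alpha> 1)) s =
    coeff (smult (- real (Suc m)) (endpoint_jacobi m (\<alpha> + 1) 0)) s"
    using assms jacobi_coeff_raise_alpha[OF assms, of m 0 s]
    apply (simp add: coeff_pderiv coeff_endpoint_jacobi jacobi_coeff_Suc divide_simps)
    apply algebra
    done
qed

text \<open>The operator \<open>u * d/du + \<alpha>\<close> multiplies the coefficient of
  \<open>u^s\<close> by \<open>s + \<alpha>\<close>. At \<open>s = j + 1\<close> this cancels the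
  denominator \<open>\<alpha> + 1 + j\<close> of the term ratio and leaves the coefficient of the
  polynomial of the next degree.\<close>

lemma endpoint_jacobi_edge:
  assumes "\<alpha> > 0"
  shows "[:0, 1:] * pderiv ([:1, -1:] * endpoint_jacobi m \<alpha> 1) +
      smult \<alpha> ([:1, -1:] * endpoint_jacobi m \<alpha> 1) =
    smult (real (Suc m)) (endpoint_jacobi (Suc m) (\<alpha> - 1) 0)" (is "?l = ?r")
proof (rule poly_eqI)
  fix s
  show "coeff ?l s = coeff ?r s"
  proof (cases s)
    case 0
    then show ?thesis
      using assms by (simp add: coeff_endpoint_jacobi jacobi_coeff_def pochhammer_rec divide_simps)
  next
    case (Suc j)
    have e: "jacobi_coeff (Suc m) (\<alpha> - 1) 0 (Suc j) =
        - (real m + \<alpha> + 1) / (real j + 1) * jacobi_coeff m \<alpha> 1 j"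
      using jacobi_coeff_lower_degree[OF assms, of m 0 j] by simp
    have c: "jacobi_coeff m \<alpha> 1 (Suc j) = jacobi_coeff m \<alpha> 1 j *
        ((real j - real m) * (real m + \<alpha> + 2 + real j)) / ((\<alpha> + 1 + real j) * (real j + 1))"
      using jacobi_coeff_Suc[of m \<alpha> 1 j] by (simp add: add_ac)
    have "\<alpha> + 1 + real j > 0" using assms by simp
    then show ?thesis
      apply (simp add: Suc e c coeff_pderiv coeff_endpoint_jacobi divide_simps)
      apply (simp add: algebra_simps)
      done
  qed
qed

lemma pderiv_endpoint_jacobi_0:
  "pderiv ([:0, 1:] * endpoint_jacobi m 1 0) = smult (real (Suc m)) (endpoint_jacobi m 0 1)"
proof (rule poly_eqI)
  fix s
  show "coeff (pderiv ([:0, 1:] * endpoint_jacobi m 1 0)) s =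
    coeff (smult (real (Suc m)) (endpoint_jacobi m 0 1)) s"
    using jacobi_coeff_raise_alpha[of 0 m 0 s]
    by (simp add: coeff_pderiv coeff_endpoint_jacobi divide_simps add_ac mult_ac)
qed

lemma endpoint_legendre:
  fixes m :: nat
  defines "H \<equiv> [:1, -1:] * endpoint_jacobi m 0 1"
    and "G \<equiv> [:0, 1:] * endpoint_jacobi m 1 0"
  shows "H + G = endpoint_jacobi m 0 0" and "H - G = endpoint_jacobi (Suc m) 0 0"
proof -
  \<comment> \<open>Relation \<open>d\<close> expresses \<open>G\<close> through the coefficients of
    \<open>H\<close>; \<open>c\<close> and \<open>c'\<close> tie those to the Legendre polynomials
    of degrees \<open>m\<close> and \<open>m + 1\<close>. Each comparison then involves multiples of
    one coefficient only.\<close>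
  have d: "jacobi_coeff m 1 0 s * (real s + 1) = jacobi_coeff m 0 1 s * (real m + 1)" for s
    using jacobi_coeff_raise_alpha[of 0 m 0 s] by (simp add: divide_simps add_ac mult_ac)
  have c: "jacobi_coeff m 0 1 s * (real m + 1) = jacobi_coeff m 0 0 s * (real m + 1 + real s)" for s
    using pochhammer_shift[of "real m + 1" s]
    by (simp add: jacobi_coeff_def add_ac mult_ac divide_simps)
  have c': "jacobi_coeff m 0 1 s * (real m + 1) = jacobi_coeff (Suc m) 0 0 s * (real m + 1 - real s)" for s
    \<comment> \<open>Here the symbol that shifts is \<open>pochhammer (- real (Suc m)) s\<close>,
      since \<open>m + 2\<close> starts the other numerator symbol in both degrees.\<close>
    using pochhammer_shift[of "- 1 - real m" s]
    by (simp add: jacobi_coeff_def add_ac mult_ac divide_simps pochhammer_fact[symmetric])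
      (simp add: algebra_simps)
  show "H + G = endpoint_jacobi m 0 0"
  proof (rule poly_eqI)
    fix s show "coeff (H + G) s = coeff (endpoint_jacobi m 0 0) s"
    proof (cases s)
      case 0
      then show ?thesis by (simp add: H_def G_def coeff_endpoint_jacobi jacobi_coeff_def)
    next
      case (Suc j)
      show ?thesis
        unfolding Suc using d[of j] c[of j]
        by (simp add: H_def G_def coeff_endpoint_jacobi jacobi_coeff_Suc divide_simps) algebra
    qed
  qed
  show "H - G = endpoint_jacobi (Suc m) 0 0"
  proof (rule poly_eqI)
    fix s show "coeff (H - G) s = coeff (endpoint_jacobi (Suc m) 0 0) s"
    proof (cases s)
      case 0
      then show ?thesis by (simp add: H_def G_def coeff_endpoint_jacobi jacobi_coeff_def pochhammer_fact[symmetric])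
    next
      case (Suc j)
      show ?thesis
        unfolding Suc using d[of j] c'[of j]
        by (simp add: H_def G_def coeff_endpoint_jacobi jacobi_coeff_Suc divide_simps) algebra
    qed
  qed
qed


section \<open>The same identities in the variable x, where the substitution
  \<open>u = 1 - x\<close> flips the sign of derivatives\<close>

lemma pderiv_shifted_jacobi_edge:
  assumes "\<alpha> > -1"
  shows "pderiv ([:0, 1:] * shifted_jacobi m \<alpha> 1) =
    smult (real (Suc m)) (shifted_jacobi m (\<alpha> + 1) 0)"
proof -
  have "[:0, 1:] * shifted_jacobi m \<alpha> 1 = ([:1, -1:] * endpoint_jacobi m \<alpha> 1) \<circ>\<^sub>p [:1, -1:]"
    by (simp only: shifted_jacobi_eq pcompose_mult) (simp add: pcompose_pCons)
  then show ?thesis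
    by (simp only: pderiv_pcompose pderiv_endpoint_jacobi_edge[OF assms] shifted_jacobi_eq pcompose_smult)
      (simp add: pderiv_pCons add_ac)
qed

lemma shifted_jacobi_edge:
  assumes "\<alpha> > 0"
  shows "smult \<alpha> ([:0, 1:] * shifted_jacobi m \<alpha> 1) -
      [:1, -1:] * pderiv ([:0, 1:] * shifted_jacobi m \<alpha> 1) =
    smult (real (Suc m)) (shifted_jacobi (Suc m) (\<alpha> - 1) 0)"
proof -
  define W where "W = [:1, -1:] * endpoint_jacobi m \<alpha> 1"
  have "[:0, 1:] * shifted_jacobi m \<alpha> 1 = W \<circ>\<^sub>p [:1, -1:]"
    unfolding W_def by (simp only: shifted_jacobi_eq pcompose_mult) (simp add: pcompose_pCons)
  moreover have "pderiv (W \<circ>\<^sub>p [:1, -1:]) = - (pderiv W \<circ>\<^sub>p [:1, -1:])"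
    by (simp add: pderiv_pcompose pderiv_pCons)
  moreover have "([:0, 1:] * pderiv W + smult \<alpha> W) \<circ>\<^sub>p [:1, -1:] =
      smult (real (Suc m)) (shifted_jacobi (Suc m) (\<alpha> - 1) 0)"
    using endpoint_jacobi_edge[OF assms, of m]
    by (simp only: W_def shifted_jacobi_eq pcompose_smult)
  moreover have "([:0, 1:] * pderiv W + smult \<alpha> W) \<circ>\<^sub>p [:1, -1:] =
      smult \<alpha> (W \<circ>\<^sub>p [:1, -1:]) + [:1, -1:] * (pderiv W \<circ>\<^sub>p [:1, -1:])"
    by (simp only: pcompose_add pcompose_mult pcompose_smult) (simp add: pcompose_pCons)
  ultimately show ?thesis
    by (simp only: mult_minus_right diff_minus_eq_add)
qed

lemma pderiv_shifted_jacobi_0: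
  "pderiv ([:1, -1:] * shifted_jacobi m 1 0) = smult (- real (Suc m)) (shifted_jacobi m 0 1)"
proof -
  have "[:1, -1:] * shifted_jacobi m 1 0 = ([:0, 1:] * endpoint_jacobi m 1 0) \<circ>\<^sub>p [:1, -1:]"
    by (simp only: shifted_jacobi_eq pcompose_mult) (simp add: pcompose_pCons)
  then show ?thesis
    by (simp only: pderiv_pcompose pderiv_endpoint_jacobi_0 shifted_jacobi_eq pcompose_smult)
      (simp add: pderiv_pCons)
qed

lemma shifted_legendre:
  "[:0, 1:] * shifted_jacobi m 0 1 + [:1, -1:] * shifted_jacobi m 1 0 = shifted_jacobi m 0 0"
  "[:0, 1:] * shifted_jacobi m 0 1 - [:1, -1:] * shifted_jacobi m 1 0 = shifted_jacobi (Suc m) 0 0"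
proof -
  have 1: "[:0, 1:] * shifted_jacobi m 0 1 = ([:1, -1:] * endpoint_jacobi m 0 1) \<circ>\<^sub>p [:1, -1:]"
    "[:1, -1:] * shifted_jacobi m 1 0 = ([:0, 1:] * endpoint_jacobi m 1 0) \<circ>\<^sub>p [:1, -1:]"
    by (simp_all only: shifted_jacobi_eq pcompose_mult) (simp_all add: pcompose_pCons)
  show "[:0, 1:] * shifted_jacobi m 0 1 + [:1, -1:] * shifted_jacobi m 1 0 = shifted_jacobi m 0 0"
    unfolding 1 unfolding pcompose_add[symmetric] endpoint_legendre shifted_jacobi_eq ..
  show "[:0, 1:] * shifted_jacobi m 0 1 - [:1, -1:] * shifted_jacobi m 1 0 = shifted_jacobi (Suc m) 0 0"
    unfolding 1 unfolding pcompose_diff[symmetric] endpoint_legendre shifted_jacobi_eq ..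
qed

lemma shifted_jacobi_degree_0 [simp]: "shifted_jacobi 0 \<alpha> \<beta> = 1"
  by (simp add: shifted_jacobi_def jacobi_poly_def)

section \<open>Bivariate polynomials in collapsed coordinates\<close>

lemma infinite_UNIV_minus_singleton: "infinite (- {a :: real})"
  by (simp add: Compl_eq_Diff_UNIV infinite_UNIV_char_0)

text \<open>Collapsed coordinates break down at \<open>x = 1\<close>, but a polynomial in
  \<open>x\<close> vanishing off one point is zero. So every constant \<open>[:y:]\<close> is a root
  of \<open>p - q\<close> over the domain of polynomials in \<open>x\<close>, which is too many
  roots unless \<open>p = q\<close>.\<close>

lemma bipoly_eqI:
  assumes "\<And>x y. x \<noteq> 1 \<Longrightarrow> eval2 p x y = eval2 q x y"
  shows "p = q"
proof -
  have "poly (p - q) [:y:] = 0" for y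
  proof (rule ccontr)
    assume "poly (p - q) [:y:] \<noteq> 0"
    from poly_roots_finite[OF this] have "finite {x. poly (poly (p - q) [:y:]) x = 0}" .
    moreover have "- {1} \<subseteq> {x. poly (poly (p - q) [:y:]) x = 0}"
      using assms by (auto simp: eval2_def)
    ultimately show False
      using infinite_UNIV_minus_singleton finite_subset by blast
  qed
  then have "range (\<lambda>y. [:y:]) \<subseteq> {t. poly (p - q) t = 0}"
    by auto
  moreover have "infinite (range (\<lambda>y :: real. [:y:]))"
    by (subst finite_image_iff) (auto simp: inj_def infinite_UNIV_char_0)
  ultimately have "p - q = 0"
    using poly_roots_finite[of "p - q"] finite_subset by blast
  then show ?thesis by simp
qed

text \<open>The chain rule applies because \<open>t = y / (1 - x)\<close> has x-derivative
  \<open>t / (1 - x)\<close>. The factorisation holds on the open set of all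
  \<open>x \<noteq> 1\<close>, so uniqueness of derivatives identifies the result with the algebraic
  \<open>d_dx\<close>.\<close>

lemma eval2_d_dx_collapsed:
  assumes "\<And>x y. x \<noteq> 1 \<Longrightarrow> eval2 p x y = poly a x * poly g (y / (1 - x))" and "x \<noteq> 1"
  shows "eval2 (d_dx p) x y = poly (pderiv a) x * poly g (y / (1 - x)) +
    poly a x * poly (pderiv g) (y / (1 - x)) * (y / (1 - x)) / (1 - x)"
proof -
  have "((\<lambda>x. poly a x * poly g (y / (1 - x))) has_field_derivative
      poly (pderiv a) x * poly g (y / (1 - x)) +
      poly a x * poly (pderiv g) (y / (1 - x)) * (y / (1 - x)) / (1 - x)) (at x)"
    using assms(2)
    by (auto intro!: derivative_eq_intros DERIV_chain2[of "poly g"] simp: field_simps power2_eq_square)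
  moreover have "((\<lambda>x. poly a x * poly g (y / (1 - x))) has_field_derivative eval2 (d_dx p) x y) (at x)"
    using assms(2)
    by (intro has_field_derivative_transform_within_open[OF has_field_derivative_d_dx, where S = "- {1}"])
      (auto simp: assms(1))
  ultimately show ?thesis
    using DERIV_unique by blast
qed

lemma eval2_d_dy_collapsed:
  assumes "\<And>x y. x \<noteq> 1 \<Longrightarrow> eval2 p x y = poly a x * poly g (y / (1 - x))" and "x \<noteq> 1"
  shows "eval2 (d_dy p) x y = poly a x * poly (pderiv g) (y / (1 - x)) / (1 - x)"
proof -
  have "((\<lambda>y. poly a x * poly g (y / (1 - x))) has_field_derivative
      poly a x * poly (pderiv g) (y / (1 - x)) / (1 - x)) (at y)"
    using assms(2)
    by (auto intro!: derivative_eq_intros DERIV_chain2[of "poly g"] simp: divide_simps)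
  moreover have "((\<lambda>y. poly a x * poly g (y / (1 - x))) has_field_derivative eval2 (d_dy p) x y) (at y)"
    using has_field_derivative_d_dy[of p x y] assms by simp
  ultimately show ?thesis
    using DERIV_unique by blast
qed

text \<open>The derivative of \<open>t = y / (1 - x)\<close> in the z-direction is
  \<open>1/(1-x) - t/(1-x) = (1-t)/(1-x)\<close>.\<close>

lemma eval2_d_dz_collapsed:
  assumes "\<And>x y. x \<noteq> 1 \<Longrightarrow> eval2 p x y = poly a x * poly g (y / (1 - x))" and "x \<noteq> 1"
  shows "eval2 (d_dz p) x y = poly a x * poly (pderiv g) (y / (1 - x)) * (1 - y / (1 - x)) / (1 - x)
    - poly (pderiv a) x * poly g (y / (1 - x))"
  using eval2_d_dx_collapsed[OF assms] eval2_d_dy_collapsed[OF assms]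
  by (simp add: d_dz_def algebra_simps diff_divide_distrib)

section \<open>Triangle polynomials and their factors in x and t\<close>

lemma eval2_jacobi_tri':
  assumes "x \<noteq> 1" "n = r + k" "\<alpha> = 2 * real k + b + c + 1"
  shows "eval2 (jacobi_tri a b c n k) x y =
    poly (shifted_jacobi r \<alpha> a) x * (1 - x) ^ k * poly (shifted_jacobi k c b) (y / (1 - x))"
  using eval2_jacobi_tri[of x a b c n k y] assms by simp

text \<open>Up to a power of \<open>1 - x\<close>, this is the x-factor of
  \<open>Q110 n (Suc m)\<close> and of \<open>Q101 n (Suc m)\<close> for
  \<open>n = r + m + 2\<close>; both have \<open>b + c = 1\<close>.\<close>

definition radial :: "nat \<Rightarrow> nat \<Rightarrow> real poly" where
  "radial r m = [:0, 1:] * shifted_jacobi r (2 * real m + 2) 1"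

lemma pderiv_radial:
  "poly (pderiv (radial r m)) x = real (Suc r) * poly (shifted_jacobi r (2 * real m + 3) 0) x"
  unfolding radial_def by (subst pderiv_shifted_jacobi_edge) (simp_all add: add_ac)

text \<open>This is the second edge identity at \<open>\<alpha> = 2 * m + 2\<close>. The two Jacobi
  polynomials on the right are the x-factors of \<open>P (r+m+1) (m+1)\<close> and
  \<open>P (r+m+1) m\<close>, up to powers of \<open>1 - x\<close>.\<close>

lemma radial_eq:
  "2 * real (Suc m) * poly (radial r m) x =
    real (Suc r) * ((1 - x) * poly (shifted_jacobi r (2 * real m + 3) 0) x +
      poly (shifted_jacobi (Suc r) (2 * real m + 1) 0) x)"
  using arg_cong[OF shifted_jacobi_edge[of "2 * real m + 2" r], of "\<lambda>p. poly p x"]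
  unfolding radial_def[symmetric] by (simp add: pderiv_radial algebra_simps)

text \<open>Put \<open>A = (1-x) * S(r,2m+3,0)\<close> and \<open>B = S(r+1,2m+1,0)\<close>. For the
  x-factor \<open>a\<close> of an interior basis polynomial, \<open>(m+1) * a / (1-x)\<close> is
  proportional to \<open>A + B\<close>, while \<open>pderiv_weighted_radial\<close> makes
  \<open>a'\<close> proportional to \<open>A - B\<close> with the same factor.\<close>

lemma weighted_radial:
  assumes "x \<noteq> 1"
  shows "real (Suc m) * poly ([:1, -1:] ^ Suc m * radial r m) x / (1 - x) =
    real (Suc r) / 2 * (1 - x) ^ m * ((1 - x) * poly (shifted_jacobi r (2 * real m + 3) 0) x
      + poly (shifted_jacobi (Suc r) (2 * real m + 1) 0) x)"
proof -
  have "real (Suc m) * poly ([:1, -1:] ^ Suc m * radial r m) x / (1 - x) =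
      (1 - x) ^ m * (2 * real (Suc m) * poly (radial r m) x) / 2"
    using assms by (simp add: poly_power del: mult_pCons_left)
  then show ?thesis
    unfolding radial_eq by (simp add: field_simps)
qed

lemma pderiv_weight: "poly (pderiv ([:1, -1:] ^ Suc m)) x = - real (Suc m) * (1 - x :: real) ^ m"
  unfolding pderiv_power_Suc by (simp add: poly_power pderiv_pCons algebra_simps)

lemma pderiv_weighted_radial:
  "poly (pderiv ([:1, -1:] ^ Suc m * radial r m)) x =
    real (Suc r) / 2 * (1 - x) ^ m * ((1 - x) * poly (shifted_jacobi r (2 * real m + 3) 0) x
      - poly (shifted_jacobi (Suc r) (2 * real m + 1) 0) x)"
proof -
  have "poly (pderiv ([:1, -1:] ^ Suc m * radial r m)) x =
      (1 - x) ^ m * ((1 - x) * poly (pderiv (radial r m)) x - (2 * real (Suc m) * poly (radial r m) x) / 2)"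
    unfolding pderiv_mult poly_add poly_mult pderiv_weight
    by (simp add: poly_power algebra_simps)
  then show ?thesis
    unfolding radial_eq pderiv_radial by (simp add: field_simps)
qed

lemma poly_shifted_legendre:
  "poly (shifted_jacobi m 0 0) t = t * poly (shifted_jacobi m 0 1) t + (1 - t) * poly (shifted_jacobi m 1 0) t"
  "poly (shifted_jacobi (Suc m) 0 0) t = t * poly (shifted_jacobi m 0 1) t - (1 - t) * poly (shifted_jacobi m 1 0) t"
  using arg_cong[OF shifted_legendre(1)[of m], of "\<lambda>p. poly p t"]
    arg_cong[OF shifted_legendre(2)[of m], of "\<lambda>p. poly p t"]
  by (simp_all add: algebra_simps)

lemma eval2_P:
  assumes "x \<noteq> 1" "n = r + k"
  shows "eval2 (P n k) x y = poly (shifted_jacobi r (2 * real k + 1) 0) x * (1 - x) ^ k *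
    poly (shifted_jacobi k 0 0) (y / (1 - x))"
  using assms by (intro eval2_jacobi_tri') auto

lemma collapse_Z: "x \<noteq> 1 \<Longrightarrow> 1 - x - y = (1 - x) * (1 - y / (1 - x :: real))"
  by (simp add: field_simps)

lemma collapse_Y: "x \<noteq> 1 \<Longrightarrow> y = (1 - x) * (y / (1 - x :: real))"
  by simp

section \<open>The derivatives of the two-edge Dirichlet bases\<close>

lemma d_dy_Q011_0: "d_dy (Q011 n 0) = 0"
proof (rule bipoly_eqI)
  fix x y :: real
  assume x: "x \<noteq> 1"
  have "eval2 (Q011 n 0) x y = poly ([:1, -1:] * shifted_jacobi (n - 1) 1 0) x * poly 1 (y / (1 - x))"
    if "x \<noteq> 1" for x y
    using that by (simp add: Q011_def eval2_P[where r = "n - 1"] algebra_simps)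
  from eval2_d_dy_collapsed[OF this x, of y] show "eval2 (d_dy (Q011 n 0)) x y = eval2 0 x y"
    by simp
qed

lemma d_dy_Q011_1: "d_dy (Q011 n 1) = scale (-2) (P (n - 1) 0)"
proof (rule bipoly_eqI)
  fix x y :: real
  assume x: "x \<noteq> 1"
  have "eval2 (Q011 n 1) x y = poly ([:1, -1:] * shifted_jacobi (n - 1) 1 0) x * poly [:1, -2:] (y / (1 - x))"
    if "x \<noteq> 1" for x y
    using that by (simp add: Q011_def eval2_P[where r = "n - 1"] field_simps)
  from eval2_d_dy_collapsed[OF this x, of y]
  have "eval2 (d_dy (Q011 n 1)) x y =
      poly ([:1, -1:] * shifted_jacobi (n - 1) 1 0) x * poly (pderiv [:1, -2:]) (y / (1 - x)) / (1 - x)" .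
  also have "\<dots> = eval2 (scale (-2) (P (n - 1) 0)) x y"
    using x by (simp add: eval2_P[where r = "n - 1"] pderiv_pCons field_simps)
  finally show "eval2 (d_dy (Q011 n 1)) x y = eval2 (scale (-2) (P (n - 1) 0)) x y" .
qed

text \<open>Since \<open>y * z = (1-x)^2 * t * (1-t)\<close>, only the t-factor is differentiated.
  The parametrisation \<open>k = m + 2\<close>, \<open>n = r + m + 2\<close> avoids truncated
  subtraction.\<close>

lemma d_dy_Q011_inner:
  "d_dy (Q011 (r + m + 2) (m + 2)) = scale (- real (Suc m)) (P (r + m + 1) (m + 1))"
proof (rule bipoly_eqI)
  fix x y :: real
  assume x: "x \<noteq> 1"
  define g where "g = [:1, -1:] * ([:0, 1:] * shifted_jacobi m 1 1)"
  \<comment> \<open>With \<open>F = t * S(m,1,1)\<close>, the product rule gives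
    \<open>g' = -(F - (1-t) * F')\<close>, the negative of the second edge identity at
    \<open>\<alpha> = 1\<close>.\<close>
  have "pderiv g = - smult (real (Suc m)) (shifted_jacobi (Suc m) 0 0)"
    using shifted_jacobi_edge[of 1 m] unfolding g_def pderiv_mult
    by (simp add: pderiv_pCons algebra_simps)
  then have g': "poly (pderiv g) t = - real (Suc m) * poly (shifted_jacobi (Suc m) 0 0) t" for t
    by (simp add: algebra_simps)
  have "eval2 (Q011 (r + m + 2) (m + 2)) x y =
      poly ([:1, -1:] ^ (m + 2) * shifted_jacobi r (2 * real m + 3) 0) x * poly g (y / (1 - x))"
    if "x \<noteq> 1" for x y
    using collapse_Y[OF that, of y] collapse_Z[OF that, of y] that
    by (simp add: Q011_def eval2_jacobi_tri'[where r = r and \<alpha> = "2 * real m + 3"] g_def poly_power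
        del: mult_pCons_left)
  from eval2_d_dy_collapsed[OF this x, of y]
  have "eval2 (d_dy (Q011 (r + m + 2) (m + 2))) x y =
      poly ([:1, -1:] ^ (m + 2) * shifted_jacobi r (2 * real m + 3) 0) x *
      poly (pderiv g) (y / (1 - x)) / (1 - x)" .
  also have "\<dots> = eval2 (scale (- real (Suc m)) (P (r + m + 1) (m + 1))) x y"
    using x by (simp add: g' eval2_P[where r = r] poly_power field_simps)
  finally show "eval2 (d_dy (Q011 (r + m + 2) (m + 2))) x y =
      eval2 (scale (- real (Suc m)) (P (r + m + 1) (m + 1))) x y" .
qed

section \<open>Derivatives in x\<close>

lemma d_dx_Q101_0:
  assumes "n \<ge> 1"
  shows "d_dx (Q101 n 0) = scale (real n) (P (n - 1) 0)"
proof (rule bipoly_eqI)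
  fix x y :: real
  assume x: "x \<noteq> 1"
  have "eval2 (Q101 n 0) x y = poly ([:0, 1:] * shifted_jacobi (n - 1) 0 1) x * poly 1 (y / (1 - x))"
    if "x \<noteq> 1" for x y
    by (simp add: Q101_def del: mult_pCons_left mult_pCons_right)
  from eval2_d_dx_collapsed[OF this x, of y]
  have "eval2 (d_dx (Q101 n 0)) x y = poly (pderiv ([:0, 1:] * shifted_jacobi (n - 1) 0 1)) x"
    by (simp del: mult_pCons_left)
  also have "\<dots> = (real n * poly (shifted_jacobi (n - 1) 1 0) x)"
    using assms by (subst pderiv_shifted_jacobi_edge) simp_all
  finally show "eval2 (d_dx (Q101 n 0)) x y = eval2 (scale (real n) (P (n - 1) 0)) x y"
    using x by (simp add: eval2_P[where r = "n - 1"])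
qed

text \<open>The derivative is a multiple of
  \<open>(A - B) * G - (A + B) * H = -(A * (H - G) + B * (H + G))\<close>, with \<open>A\<close>,
  \<open>B\<close> as in \<open>weighted_radial\<close>. The Legendre identities turn the two
  products into the two members of \<open>P\<close>.\<close>

lemma d_dx_Q101_inner:
  "d_dx (Q101 (r + m + 2) (Suc m)) =
    scale (- real (Suc r) / 2) (P (r + m + 1) m + P (r + m + 1) (Suc m))"
proof (rule bipoly_eqI)
  fix x y :: real
  assume x: "x \<noteq> 1"
  define t where "t = y / (1 - x)"
  define a where "a = [:1, -1:] ^ Suc m * radial r m"
  define g where "g = [:1, -1:] * shifted_jacobi m 1 0"
  have g: "poly g t = (1 - t) * poly (shifted_jacobi m 1 0) t"
    by (simp add: g_def algebra_simps)
  have g': "poly (pderiv g) t = - real (Suc m) * poly (shifted_jacobi m 0 1) t"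
    unfolding g_def by (subst pderiv_shifted_jacobi_0) (simp add: algebra_simps)
  have "eval2 (Q101 (r + m + 2) (Suc m)) x y = poly a x * poly g (y / (1 - x))"
    if "x \<noteq> 1" for x y
    using collapse_Z[OF that, of y] that
    by (simp add: Q101_def eval2_jacobi_tri'[where r = r and \<alpha> = "2 * real m + 2"] a_def g_def
        radial_def poly_power
        del: mult_pCons_left)
  from eval2_d_dx_collapsed[OF this x, of y, folded t_def]
  have "eval2 (d_dx (Q101 (r + m + 2) (Suc m))) x y =
      poly (pderiv a) x * poly g t + poly a x * poly (pderiv g) t * t / (1 - x)" .
  also have "\<dots> = poly (pderiv a) x * ((1 - t) * poly (shifted_jacobi m 1 0) t) - (real (Suc m) * poly a x / (1 - x)) * (t * poly (shifted_jacobi m 0 1) t)"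
    using x unfolding g g' by (simp add: field_simps)
  also have "\<dots> = eval2 (scale (- real (Suc r) / 2) (P (r + m + 1) m + P (r + m + 1) (Suc m))) x y"
    using x unfolding a_def weighted_radial[OF x] pderiv_weighted_radial
    by (simp add: eval2_P[where r = r] eval2_P[where r = "Suc r"] poly_shifted_legendre[of m] t_def[symmetric] field_simps)
  finally show "eval2 (d_dx (Q101 (r + m + 2) (Suc m))) x y =
      eval2 (scale (- real (Suc r) / 2) (P (r + m + 1) m + P (r + m + 1) (Suc m))) x y" .
qed

text \<open>No Jacobi factor in \<open>x\<close> remains, and
  \<open>a' = -(m+1) * a / (1-x)\<close>. So \<open>H\<close> and \<open>G\<close> enter with the
  same sign, and their sum is the Legendre polynomial of degree \<open>m\<close>.\<close>

lemma d_dx_Q101_diag: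
  "d_dx (Q101 (Suc m) (Suc m)) =
    scale (- real (Suc m)) (P m m)"
proof (rule bipoly_eqI)
  fix x y :: real
  assume x: "x \<noteq> 1"
  define t where "t = y / (1 - x)"
  define a where "a = [:1, -1 :: real:] ^ Suc m"
  define g where "g = [:1, -1:] * shifted_jacobi m 1 0"
  have g: "poly g t = (1 - t) * poly (shifted_jacobi m 1 0) t"
    by (simp add: g_def algebra_simps)
  have g': "poly (pderiv g) t = - real (Suc m) * poly (shifted_jacobi m 0 1) t"
    unfolding g_def by (subst pderiv_shifted_jacobi_0) (simp add: algebra_simps)
  have "eval2 (Q101 (Suc m) (Suc m)) x y = poly a x * poly g (y / (1 - x))"
    if "x \<noteq> 1" for x y
    using collapse_Z[OF that, of y] that
    by (simp add: Q101_def eval2_jacobi_tri'[where r = 0] a_def g_def poly_power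
        del: mult_pCons_left)
  from eval2_d_dx_collapsed[OF this x, of y, folded t_def]
  have "eval2 (d_dx (Q101 (Suc m) (Suc m))) x y =
      poly (pderiv a) x * poly g t + poly a x * poly (pderiv g) t * t / (1 - x)" .
  also have "\<dots> = poly (pderiv a) x * ((1 - t) * poly (shifted_jacobi m 1 0) t) - (real (Suc m) * poly a x / (1 - x)) * (t * poly (shifted_jacobi m 0 1) t)"
    using x unfolding g g' by (simp add: field_simps)
  also have "\<dots> = eval2 (scale (- real (Suc m)) (P m m)) x y"
    using x unfolding a_def pderiv_weight
    by (simp add: eval2_P[where r = 0] poly_shifted_legendre[of m] t_def[symmetric] field_simps)
  finally show "eval2 (d_dx (Q101 (Suc m) (Suc m))) x y =
      eval2 (scale (- real (Suc m)) (P m m)) x y" .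
qed

section \<open>Derivatives in z\<close>

lemma d_dz_Q110_0:
  assumes "n \<ge> 1"
  shows "d_dz (Q110 n 0) = scale (- real n) (P (n - 1) 0)"
proof (rule bipoly_eqI)
  fix x y :: real
  assume x: "x \<noteq> 1"
  have "eval2 (Q110 n 0) x y = poly ([:0, 1:] * shifted_jacobi (n - 1) 0 1) x * poly 1 (y / (1 - x))"
    if "x \<noteq> 1" for x y
    by (simp add: Q110_def del: mult_pCons_left mult_pCons_right)
  from eval2_d_dz_collapsed[OF this x, of y]
  have "eval2 (d_dz (Q110 n 0)) x y = - poly (pderiv ([:0, 1:] * shifted_jacobi (n - 1) 0 1)) x"
    by (simp del: mult_pCons_left)
  also have "\<dots> = - (real n * poly (shifted_jacobi (n - 1) 1 0) x)"
    using assms by (subst pderiv_shifted_jacobi_edge) simp_all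
  finally show "eval2 (d_dz (Q110 n 0)) x y = eval2 (scale (- real n) (P (n - 1) 0)) x y"
    using x by (simp add: eval2_P[where r = "n - 1"])
qed

text \<open>Compared with the x-derivative of \<open>Q101\<close>, the roles of \<open>H\<close> and
  \<open>G\<close> are exchanged:
  \<open>(A + B) * G - (A - B) * H = B * (H + G) - A * (H - G)\<close>, which accounts for the
  difference of two members of \<open>P\<close>.\<close>

lemma d_dz_Q110_inner:
  "d_dz (Q110 (r + m + 2) (Suc m)) =
    scale (real (Suc r) / 2) (P (r + m + 1) m - P (r + m + 1) (Suc m))"
proof (rule bipoly_eqI)
  fix x y :: real
  assume x: "x \<noteq> 1"
  define t where "t = y / (1 - x)"
  define a where "a = [:1, -1:] ^ Suc m * radial r m"
  define g where "g = [:0, 1:] * shifted_jacobi m 0 1"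
  have g: "poly g t = t * poly (shifted_jacobi m 0 1) t"
    by (simp add: g_def algebra_simps)
  have g': "poly (pderiv g) t = real (Suc m) * poly (shifted_jacobi m 1 0) t"
    unfolding g_def by (subst pderiv_shifted_jacobi_edge) (simp_all add: algebra_simps)
  have "eval2 (Q110 (r + m + 2) (Suc m)) x y = poly a x * poly g (y / (1 - x))"
    if "x \<noteq> 1" for x y
    using collapse_Y[OF that, of y] that
    by (simp add: Q110_def eval2_jacobi_tri'[where r = r and \<alpha> = "2 * real m + 2"] a_def g_def
        radial_def poly_power
        del: mult_pCons_left)
  from eval2_d_dz_collapsed[OF this x, of y, folded t_def]
  have "eval2 (d_dz (Q110 (r + m + 2) (Suc m))) x y =
      poly a x * poly (pderiv g) t * (1 - t) / (1 - x) - poly (pderiv a) x * poly g t" .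
  also have "\<dots> = (real (Suc m) * poly a x / (1 - x)) * ((1 - t) * poly (shifted_jacobi m 1 0) t) - poly (pderiv a) x * (t * poly (shifted_jacobi m 0 1) t)"
    using x unfolding g g' by (simp add: field_simps)
  also have "\<dots> = eval2 (scale (real (Suc r) / 2) (P (r + m + 1) m - P (r + m + 1) (Suc m))) x y"
    using x unfolding a_def weighted_radial[OF x] pderiv_weighted_radial
    by (simp add: eval2_P[where r = r] eval2_P[where r = "Suc r"] poly_shifted_legendre[of m] t_def[symmetric] field_simps)
  finally show "eval2 (d_dz (Q110 (r + m + 2) (Suc m))) x y =
      eval2 (scale (real (Suc r) / 2) (P (r + m + 1) m - P (r + m + 1) (Suc m))) x y" .
qed

lemma d_dz_Q110_diag:
  "d_dz (Q110 (Suc m) (Suc m)) =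
    scale (real (Suc m)) (P m m)"
proof (rule bipoly_eqI)
  fix x y :: real
  assume x: "x \<noteq> 1"
  define t where "t = y / (1 - x)"
  define a where "a = [:1, -1 :: real:] ^ Suc m"
  define g where "g = [:0, 1:] * shifted_jacobi m 0 1"
  have g: "poly g t = t * poly (shifted_jacobi m 0 1) t"
    by (simp add: g_def algebra_simps)
  have g': "poly (pderiv g) t = real (Suc m) * poly (shifted_jacobi m 1 0) t"
    unfolding g_def by (subst pderiv_shifted_jacobi_edge) (simp_all add: algebra_simps)
  have "eval2 (Q110 (Suc m) (Suc m)) x y = poly a x * poly g (y / (1 - x))"
    if "x \<noteq> 1" for x y
    using collapse_Y[OF that, of y] that
    by (simp add: Q110_def eval2_jacobi_tri'[where r = 0] a_def g_def poly_power
        del: mult_pCons_left)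
  from eval2_d_dz_collapsed[OF this x, of y, folded t_def]
  have "eval2 (d_dz (Q110 (Suc m) (Suc m))) x y =
      poly a x * poly (pderiv g) t * (1 - t) / (1 - x) - poly (pderiv a) x * poly g t" .
  also have "\<dots> = (real (Suc m) * poly a x / (1 - x)) * ((1 - t) * poly (shifted_jacobi m 1 0) t) - poly (pderiv a) x * (t * poly (shifted_jacobi m 0 1) t)"
    using x unfolding g g' by (simp add: field_simps)
  also have "\<dots> = eval2 (scale (real (Suc m)) (P m m)) x y"
    using x unfolding a_def pderiv_weight
    by (simp add: eval2_P[where r = 0] poly_shifted_legendre[of m] t_def[symmetric] field_simps)
  finally show "eval2 (d_dz (Q110 (Suc m) (Suc m))) x y =
      eval2 (scale (real (Suc m)) (P m m)) x y" .
qed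

theorem corollaryC4:
  fixes n :: nat
  assumes "n \<ge> 1"
  shows "(d_dy (Q011 n 0) = 0
       \<and> d_dy (Q011 n 1) = scale (-2) (P (n - 1) 0)
       \<and> (\<forall>k. 2 \<le> k \<and> k \<le> n \<longrightarrow>
            d_dy (Q011 n k) = scale (1 - real k) (P (n - 1) (k - 1))))
     \<and> (d_dx (Q101 n 0) = scale (real n) (P (n - 1) 0)
       \<and> (\<forall>k. 1 \<le> k \<and> k \<le> n - 1 \<longrightarrow>
            d_dx (Q101 n k) =
              scale ((real k - real n) / 2) (P (n - 1) (k - 1) + P (n - 1) k))
       \<and> d_dx (Q101 n n) = scale (- real n) (P (n - 1) (n - 1)))
     \<and> (d_dz (Q110 n 0) = scale (- real n) (P (n - 1) 0)
       \<and> (\<forall>k. 1 \<le> k \<and> k \<le> n - 1 \<longrightarrow>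
            d_dz (Q110 n k) =
              scale ((real n - real k) / 2) (P (n - 1) (k - 1) - P (n - 1) k))
       \<and> d_dz (Q110 n n) = scale (real n) (P (n - 1) (n - 1)))"
proof (intro conjI allI impI)
  show "d_dy (Q011 n 0) = 0"
    by (rule d_dy_Q011_0)
  show "d_dy (Q011 n 1) = scale (-2) (P (n - 1) 0)"
    by (rule d_dy_Q011_1)
  show "d_dx (Q101 n 0) = scale (real n) (P (n - 1) 0)"
    using assms by (rule d_dx_Q101_0)
  show "d_dz (Q110 n 0) = scale (- real n) (P (n - 1) 0)"
    using assms by (rule d_dz_Q110_0)
  obtain j where "n = Suc j"
    using assms by (cases n) auto
  then show "d_dx (Q101 n n) = scale (- real n) (P (n - 1) (n - 1))"
    and "d_dz (Q110 n n) = scale (real n) (P (n - 1) (n - 1))"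
    using d_dx_Q101_diag[of j] d_dz_Q110_diag[of j] by simp_all
next
  fix k
  assume "2 \<le> k \<and> k \<le> n"
  then obtain m r where "k = m + 2" "n = r + m + 2"
    by (metis add.commute add.left_commute le_Suc_ex)
  then show "d_dy (Q011 n k) = scale (1 - real k) (P (n - 1) (k - 1))"
    using d_dy_Q011_inner[of r m] by simp
next
  fix k
  assume "1 \<le> k \<and> k \<le> n - 1"
  \<comment> \<open>The witnesses are \<open>m = k - 1\<close> and \<open>r = n - k - 1\<close>, so
    \<open>Suc r\<close> is the factor \<open>n - k\<close> of the claim.\<close>
  then have "k = Suc (k - 1)" "n = (n - k - 1) + (k - 1) + 2"
    by auto
  then obtain m r where "k = Suc m" "n = r + m + 2"
    by metis
  then show "d_dx (Q101 n k) = scale ((real k - real n) / 2) (P (n - 1) (k - 1) + P (n - 1) k)"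
    and "d_dz (Q110 n k) = scale ((real n - real k) / 2) (P (n - 1) (k - 1) - P (n - 1) k)"
    using d_dx_Q101_inner[of r m] d_dz_Q110_inner[of r m] by simp_all
qed

end
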